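(* Let $s\in\{1,\dots,n\}$ and let $X\in\mathcal{H}$ have a decomposition $X=HV^\top$ with $H\in\mathbb{R}^{m\times s}$ and $V\in\mathrm{St}(n,s)$. Then $$\mathrm{T}_X\mathcal{H}=\{KV^\top+BV_\bot^\top:\ K\in\mathrm{T}_H\mathcal{H}^s,\ B\in\mathbb{R}^{m\times(n-s)}\}=(\mathrm{T}_H\mathcal{H}^s)V^\top\oplus(\mathbb{R}^{m\times(n-s)})V_\bot^\top,$$ where $\oplus$ denotes the direct sum. Moreover, $$\mathrm{N}_X\mathcal{H}=\{NV^\top:\ N\in\mathrm{N}_H\mathcal{H}^s\}=(\mathrm{N}_H\mathcal{H}^s)V^\top.$$
   Context: The map $h:\mathbb{R}^{m\times n}\to\mathbb{R}^q$ is smooth and orthogonally invariant, i.e. $h(XQ)=h(X)$ for all $X\in\mathbb{R}^{m\times n}$ and all $Q\in\mathcal{O}(n)=\{Q\in\mathbb{R}^{n\times n}:Q^\top Q=I_n\}$. Put $\mathcal{H}=\{X\in\mathbb{R}^{m\times n}:h(X)=0\}$; it is assumed that the differential $\mathrm{D}h_X$ has rank $q$ for all $X\in\mathcal{H}$ (so $\mathcal{H}$ is an embedded submanifold of $\mathbb{R}^{m\times n}$). For $s=1,\dots,n$ define $h^s:\mathbb{R}^{m\times s}\to\mathbb{R}^q$, $h^s(H)=h([H\ \ 0^{m\times(n-s)}])$, and $\mathcal{H}^s=\{H\in\mathbb{R}^{m\times s}:h^s(H)=0\}$, which, when nonempty, is an embedded submanifold of $\mathbb{R}^{m\times s}$.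 If $X=HV^\top\in\mathcal{H}$ with $V\in\mathrm{St}(n,s)$, then $H\in\mathcal{H}^s$. $\mathrm{St}(n,s)=\{V\in\mathbb{R}^{n\times s}:V^\top V=I_s\}$; $V_\bot$ denotes a matrix with $[V\ V_\bot]\in\mathcal{O}(n)$. $\mathrm{T}$ and $\mathrm{N}$ denote tangent and normal spaces with respect to the inner product $\langle A,B\rangle=\mathrm{tr}(A^\top B)$. *)

theory Defs
  imports "HOL-Analysis.Analysis"
begin

text \<open>\<open>smooth_on\<close> is meant for open sets, where the derivative \<^emph>\<open>at\<close> a point is the right notion.\<close>

primrec C_k_on :: "nat \<Rightarrow> 'a::real_normed_vector set \<Rightarrow> ('a \<Rightarrow> 'b::real_normed_vector) \<Rightarrow> bool" where
  "C_k_on 0 S f \<longleftrightarrow> continuous_on S f"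
| "C_k_on (Suc k) S f \<longleftrightarrow>
     (\<forall>x\<in>S. f differentiable at x) \<and> (\<forall>v. C_k_on k S (\<lambda>x. frechet_derivative f (at x) v))"

definition smooth_on :: "'a::real_normed_vector set \<Rightarrow> ('a \<Rightarrow> 'b::real_normed_vector) \<Rightarrow> bool" where
  "smooth_on S f \<longleftrightarrow> (\<forall>k. C_k_on k S f)"

definition tangent_space_at :: "'a::real_normed_vector set \<Rightarrow> 'a \<Rightarrow> 'a set" where
  "tangent_space_at M x =
     {v. \<exists>c e. 0 < e \<and> smooth_on {-e<..<e} c \<and> c 0 = x \<and> c ` {-e<..<e} \<subseteq> M \<and>
               (c has_vector_derivative v) (at (0::real))}"

definition normal_space_at :: "(real^'n^'m) set \<Rightarrow> real^'n^'m \<Rightarrow> (real^'n^'m) set" where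
  "normal_space_at M x = {A. \<forall>B\<in>tangent_space_at M x. trace (transpose A ** B) = 0}"

definition zero_set :: "('a \<Rightarrow> 'b::zero) \<Rightarrow> 'a set" where
  "zero_set f = {x. f x = 0}"

definition Stiefel :: "(real^'s^'n) set" where
  "Stiefel = {V. transpose V ** V = mat 1}"

definition is_direct_sum :: "'a::real_vector set \<Rightarrow> 'a set \<Rightarrow> 'a set \<Rightarrow> bool" where
  "is_direct_sum W A B \<longleftrightarrow>
     subspace A \<and> subspace B \<and> W = {a + b | a b. a \<in> A \<and> b \<in> B} \<and> A \<inter> B = {0}"

text \<open>Matrices with \<open>n - s\<close> columns cannot be indexed by a type, since \<open>s = n\<close> is allowed and
  types are nonempty. A real matrix with \<open>k \<ge> 0\<close> columns and rows indexed by \<open>'m\<close> is therefore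
  given by its sequence of columns, numbered \<open>0, \<dots>, k - 1\<close> and padded with zeros.\<close>

definition col_mats :: "nat \<Rightarrow> (nat \<Rightarrow> real^'m) set" where
  "col_mats k = {B. \<forall>l\<ge>k. B l = 0}"

text \<open>The product \<open>B C\<^sup>T\<close> of two matrices with \<open>k\<close> columns.\<close>

definition cols_mult_transpose :: "nat \<Rightarrow> (nat \<Rightarrow> real^'m) \<Rightarrow> (nat \<Rightarrow> real^'n) \<Rightarrow> real^'n^'m" where
  "cols_mult_transpose k B C = (\<chi> i j. \<Sum>l<k. B l $ i * C l $ j)"

text \<open>The block matrix \<open>[A C]\<close>. The linear order of the index types determines which columns come
  first: \<open>card {..<j}\<close> is the position, counted from 0, of the column index \<open>j\<close>.\<close>

definition hcat :: "real^'s::{finite,linorder}^'m \<Rightarrow> (nat \<Rightarrow> real^'m) \<Rightarrow> real^'n::{finite,linorder}^'m" where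
  "hcat A C = (\<chi> i j. let p = card {..<j} in
     if p < CARD('s) then A $ i $ (sorted_list_of_set UNIV ! p) else C (p - CARD('s)) $ i)"

definition zero_pad_restr :: "(real^'n::{finite,linorder}^'m \<Rightarrow> 'b) \<Rightarrow> real^'s::{finite,linorder}^'m \<Rightarrow> 'b" where
  "zero_pad_restr h H = h (hcat H (\<lambda>_. 0))"

end

theory Submission
  imports Defs
begin

text \<open>
  Write \<open>D\<close> for the differential of \<open>h\<close> at \<open>X = H V\<^sup>T\<close> and \<open>h\<^sup>s\<close> for the restriction of \<open>h\<close> to zero
  padded matrices. The whole proposition rests on one identity,
  \<open>D Y = D h\<^sup>s\<^sub>H (Y V)\<close> for all \<open>Y\<close>, and on the description of the tangent space of a regular level set
  as the kernel of the differential.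

  The identity comes from two orthogonal matrices. The reflection \<open>S = 2 V V\<^sup>T - I\<close> fixes \<open>X\<close> under
  right multiplication and sends every \<open>Y\<close> with \<open>Y V = 0\<close> to \<open>-Y\<close>. Hence invariance of \<open>h\<close> gives
  \<open>D Y = D (Y S) = - D Y\<close>, so \<open>D\<close> depends only on the component \<open>Y V V\<^sup>T\<close> of \<open>Y\<close>. Moreover any two
  Stiefel matrices differ by an orthogonal matrix on the left. Comparing \<open>V\<close> with the first \<open>s\<close>
  columns of the identity yields \<open>h (K V\<^sup>T) = h\<^sup>s K\<close> for every \<open>K\<close>, so that \<open>D (K V\<^sup>T) = D h\<^sup>s\<^sub>H K\<close>.
  Both facts are collected in \<open>derivative_of_invariant\<close>.

  The identity shows in particular that \<open>D h\<^sup>s\<^sub>H\<close> inherits surjectivity from \<open>D\<close>, so both level sets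
  are regular at the points in question and \<open>tangent_space_zero_set\<close> turns the identity into
  \<open>T\<^sub>X = {Y. Y V \<in> T\<^sub>H}\<close>. From here only linear algebra is left. Every \<open>Y\<close> splits as
  \<open>Y V V\<^sup>T + (Y - Y V V\<^sup>T)\<close>, and the matrices annihilated by \<open>V\<close> are those of the form \<open>B V\<^sub>\<bottom>\<^sup>T\<close>
  (\<open>orthogonal_completion_image\<close>); this is the direct sum. The normal space follows because
  \<open>N \<mapsto> N V\<^sup>T\<close> is the adjoint of \<open>Y \<mapsto> Y V\<close> (\<open>normal_space_of_preimage\<close>).

  The analytic part is the inclusion of the kernel in the tangent space, which asks for a curve that
  has derivatives of all orders and stays in the level set. The inverse function theorem supplies a
  differentiable one; its velocity solves a linear system with coefficients that are smooth along the
  curve, and Cramer's rule then raises its order of differentiability step by step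
  (\<open>kernel_vector_is_tangent\<close>).
\<close>

section \<open>Calculus of \<open>C\<^sup>k\<close> functions\<close>

lemma C_k_on_cong:
  assumes "C_k_on k S f" "open S" "\<And>x. x \<in> S \<Longrightarrow> f x = g x"
  shows "C_k_on k S g"
  using assms(1,3)
proof (induction k arbitrary: f g)
  case 0
  then show ?case using continuous_on_cong[of S S f g] by auto
next
  case (Suc k)
  have diff: "f differentiable at x" if "x \<in> S" for x
    using Suc.prems(1) that by auto
  have eq: "frechet_derivative f (at x) = frechet_derivative g (at x)" if "x \<in> S" for x
    using diff[OF that] \<open>open S\<close> that Suc.prems(2)
    by (rule frechet_derivative_transform_within_open)
  have "g differentiable at x" if "x \<in> S" for x
  proof -
    obtain D where "(f has_derivative D) (at x)"
      using diff[OF \<open>x \<in> S\<close>] unfolding differentiable_def ..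
    then have "(g has_derivative D) (at x)"
      using \<open>open S\<close> that Suc.prems(2) by (rule has_derivative_transform_within_open)
    then show ?thesis by (rule differentiableI)
  qed
  moreover have "C_k_on k S (\<lambda>x. frechet_derivative g (at x) v)" for v
    by (rule Suc.IH[of "\<lambda>x. frechet_derivative f (at x) v"]) (use Suc.prems(1) eq in auto)
  ultimately show ?case by simp
qed

text \<open>This is the working form of the recursion: any explicit formula for the derivative may take the
  place of \<^const>\<open>frechet_derivative\<close>, since only its values on the open set \<open>S\<close> matter.\<close>

lemma C_k_on_SucI:
  assumes "open S" "\<And>x. x \<in> S \<Longrightarrow> (f has_derivative D x) (at x)"
    and "\<And>v. C_k_on k S (\<lambda>x. D x v)"
  shows "C_k_on (Suc k) S f"
proof -
  have "C_k_on k S (\<lambda>x. frechet_derivative f (at x) v)" for v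
    by (rule C_k_on_cong[OF assms(3)[of v] \<open>open S\<close>]) (simp add: frechet_derivative_at[OF assms(2), symmetric])
  with assms(2) show ?thesis by (auto simp: differentiable_def)
qed

lemma C_k_on_SucD:
  assumes "C_k_on (Suc k) S f"
  shows "x \<in> S \<Longrightarrow> (f has_derivative frechet_derivative f (at x)) (at x)"
    and "C_k_on k S (\<lambda>x. frechet_derivative f (at x) v)"
  using assms by (auto simp: frechet_derivative_works)

lemma smooth_on_has_derivative:
  assumes "smooth_on S f" "x \<in> S"
  shows "(f has_derivative frechet_derivative f (at x)) (at x)"
proof -
  have "C_k_on (Suc 0) S f" using assms(1) unfolding smooth_on_def ..
  then show ?thesis using assms(2) by (rule C_k_on_SucD(1))
qed

text \<open>The recursive clause does not mention continuity of \<open>f\<close> itself. It enters at the bottom of the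
  recursion, where differentiability supplies it.\<close>

lemma C_k_on_Suc_imp:
  assumes "C_k_on (Suc k) S f"
  shows "C_k_on k S f"
  using assms
proof (induction k arbitrary: f)
  case 0
  then show ?case
    by (auto intro!: continuous_at_imp_continuous_on differentiable_imp_continuous_within)
next
  case (Suc k)
  then have "C_k_on (Suc k) S (\<lambda>x. frechet_derivative f (at x) v)" for v
    by (rule_tac C_k_on_SucD(2))
  then have "C_k_on k S (\<lambda>x. frechet_derivative f (at x) v)" for v
    by (rule Suc.IH)
  then show ?case using Suc.prems by (simp del: C_k_on.simps(2) add: C_k_on.simps(2)[of k]) auto
qed

lemma C_k_on_const: "C_k_on k S (\<lambda>x. c)"
  by (induction k arbitrary: c) auto

lemma C_k_on_linear:
  assumes "bounded_linear L" "open S"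
  shows "C_k_on k S L"
proof (cases k)
  case 0
  then show ?thesis using assms(1) linear_continuous_on by auto
next
  case (Suc j)
  have "C_k_on (Suc j) S L"
    by (rule C_k_on_SucI[OF assms(2), where D = "\<lambda>_. L"])
       (auto intro: bounded_linear_imp_has_derivative assms(1) C_k_on_const)
  with Suc show ?thesis by simp
qed

lemma C_k_on_add:
  assumes "open S" "C_k_on k S f" "C_k_on k S g"
  shows "C_k_on k S (\<lambda>x. f x + g x)"
  using assms(2,3)
proof (induction k arbitrary: f g)
  case 0
  then show ?case by (auto intro: continuous_on_add)
next
  case (Suc k)
  show ?case
    by (rule C_k_on_SucI[OF assms(1) has_derivative_add[OF Suc.prems[THEN C_k_on_SucD(1)]]])
       (auto intro: Suc.IH Suc.prems[THEN C_k_on_SucD(2)])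
qed

lemma C_k_on_sum:
  assumes "open S" "\<And>i. i \<in> I \<Longrightarrow> C_k_on k S (f i)"
  shows "C_k_on k S (\<lambda>x. \<Sum>i\<in>I. f i x)"
  using assms(2)
  by (induction I rule: infinite_finite_induct) (auto intro: C_k_on_const C_k_on_add[OF assms(1)])

text \<open>The product rule expresses the derivative by the same bilinear map, applied to functions that are
  of class \<open>C\<^sup>k\<close>. One induction therefore covers products, scaling and inner products.\<close>

lemma C_k_on_bilinear:
  assumes "bounded_bilinear b" "open S" "C_k_on k S f" "C_k_on k S g"
  shows "C_k_on k S (\<lambda>x. b (f x) (g x))"
  using assms(3,4)
proof (induction k arbitrary: f g)
  case 0
  then show ?case by (auto intro: bounded_bilinear.continuous_on[OF assms(1)])
next
  case (Suc k)
  show ?case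
    by (rule C_k_on_SucI[OF assms(2) bounded_bilinear.FDERIV[OF assms(1) Suc.prems[THEN C_k_on_SucD(1)]]])
       (auto intro!: C_k_on_add Suc.IH assms(2) Suc.prems[THEN C_k_on_SucD(2)] Suc.prems[THEN C_k_on_Suc_imp])
qed

lemmas C_k_on_mult = C_k_on_bilinear[OF bounded_bilinear_mult]
lemmas C_k_on_scaleR = C_k_on_bilinear[OF bounded_bilinear_scaleR]

lemma C_k_on_prod:
  fixes f :: "'i \<Rightarrow> 'a::real_normed_vector \<Rightarrow> real"
  assumes "open S" "\<And>i. i \<in> I \<Longrightarrow> C_k_on k S (f i)"
  shows "C_k_on k S (\<lambda>x. \<Prod>i\<in>I. f i x)"
  using assms(2)
  by (induction I rule: infinite_finite_induct) (auto intro: C_k_on_const C_k_on_mult[OF assms(1)])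

lemma C_k_on_inverse:
  fixes f :: "'a::real_normed_vector \<Rightarrow> real"
  assumes "open S" "C_k_on k S f" "\<And>x. x \<in> S \<Longrightarrow> f x \<noteq> 0"
  shows "C_k_on k S (\<lambda>x. inverse (f x))"
  using assms(2)
proof (induction k)
  case 0
  then show ?case using assms(3) by (auto intro: continuous_on_inverse)
next
  case (Suc k)
  note inv = Suc.IH[OF C_k_on_Suc_imp[OF Suc.prems]]
  show ?case
  proof (rule C_k_on_SucI[OF assms(1)])
    show "((\<lambda>x. inverse (f x)) has_derivative
        (\<lambda>v. - 1 * (inverse (f x) * frechet_derivative f (at x) v * inverse (f x)))) (at x)"
      if "x \<in> S" for x
      using Deriv.has_derivative_inverse[OF assms(3)[OF that] C_k_on_SucD(1)[OF Suc.prems that]]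
      by simp
    show "C_k_on k S (\<lambda>x. - 1 * (inverse (f x) * frechet_derivative f (at x) v * inverse (f x)))" for v
      by (intro C_k_on_mult assms(1) inv C_k_on_SucD(2)[OF Suc.prems] C_k_on_const)
  qed
qed

text \<open>The induction needs the derivative of the composite in terms of functions of the form \<open>g (c x)\<close> with
  a fixed \<open>g\<close>. The chain rule gives \<open>Df (c x) (Dc x v)\<close>, where the direction varies with \<open>x\<close>; expanding
  that direction in a basis leaves only the partial derivatives \<open>Df (c x) b\<close>, to which the induction
  hypothesis applies.\<close>

lemma C_k_on_compose:
  fixes c :: "'a::real_normed_vector \<Rightarrow> 'b::euclidean_space"
    and f :: "'b \<Rightarrow> 'c::real_normed_vector"
  assumes "open S" "C_k_on k T f" "C_k_on k S c" "c ` S \<subseteq> T"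
  shows "C_k_on k S (\<lambda>x. f (c x))"
  using assms(2,3)
proof (induction k arbitrary: f)
  case 0
  then show ?case using assms(4) continuous_on_compose2[of T f S c] by auto
next
  case (Suc k)
  show ?case
  proof (rule C_k_on_SucI[OF assms(1)])
    fix x assume "x \<in> S"
    let ?Df = "frechet_derivative f (at (c x))" and ?Dc = "frechet_derivative c (at x)"
    have Df: "(f has_derivative ?Df) (at (c x))"
      using C_k_on_SucD(1)[OF Suc.prems(1)] \<open>x \<in> S\<close> assms(4) by auto
    have "?Df (?Dc v) = (\<Sum>b\<in>Basis. (?Dc v \<bullet> b) *\<^sub>R ?Df b)" for v
    proof -
      have "?Df (?Dc v) = ?Df (\<Sum>b\<in>Basis. (?Dc v \<bullet> b) *\<^sub>R b)"
        by (simp add: euclidean_representation)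
      also have "\<dots> = (\<Sum>b\<in>Basis. (?Dc v \<bullet> b) *\<^sub>R ?Df b)"
        using has_derivative_linear[OF Df] by (simp add: linear_sum linear_scale)
      finally show ?thesis .
    qed
    with has_derivative_compose[OF C_k_on_SucD(1)[OF Suc.prems(2) \<open>x \<in> S\<close>] Df]
    show "((\<lambda>x. f (c x)) has_derivative (\<lambda>v. \<Sum>b\<in>Basis. (?Dc v \<bullet> b) *\<^sub>R ?Df b)) (at x)"
      by simp
  next
    fix v
    show "C_k_on k S (\<lambda>x. \<Sum>b\<in>Basis. (frechet_derivative c (at x) v \<bullet> b) *\<^sub>R
            frechet_derivative f (at (c x)) b)"
      by (intro C_k_on_sum C_k_on_scaleR assms(1) Suc.IH C_k_on_SucD(2)[OF Suc.prems(1)]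
          C_k_on_Suc_imp[OF Suc.prems(2)] C_k_on_const
          C_k_on_bilinear[OF bounded_bilinear_inner] C_k_on_SucD(2)[OF Suc.prems(2)])
  qed
qed

lemma C_k_on_det:
  fixes M :: "'a::real_normed_vector \<Rightarrow> real^'n^'n"
  assumes "open S" "\<And>i j. C_k_on k S (\<lambda>x. M x $ i $ j)"
  shows "C_k_on k S (\<lambda>x. det (M x))"
  unfolding det_def
  by (intro C_k_on_sum C_k_on_mult C_k_on_prod C_k_on_const assms)

section \<open>Tangent spaces of regular level sets\<close>

lemma has_derivative_locally_constant:
  assumes "open S" "x \<in> S" "\<And>y. y \<in> S \<Longrightarrow> f y = a"
  shows "(f has_derivative (\<lambda>_. 0)) (at x)"
proof (rule has_derivative_transform_within_open)
  show "((\<lambda>_. a) has_derivative (\<lambda>_. 0)) (at x)" by (rule has_derivative_const)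
qed (use assms in auto)

lemma tangent_vector_in_kernel:
  assumes f: "(f has_derivative Df) (at x)" and v: "v \<in> tangent_space_at (zero_set f) x"
  shows "Df v = 0"
proof -
  obtain c e where e: "0 < e" "c 0 = x" "c ` {-e<..<e} \<subseteq> zero_set f"
    and c: "(c has_vector_derivative v) (at (0::real))"
    using v unfolding tangent_space_at_def by blast
  have "(f has_derivative Df) (at (c 0))"
    using f e(2) by simp
  with c have "((\<lambda>t. f (c t)) has_derivative (\<lambda>s. Df (s *\<^sub>R v))) (at 0)"
    using has_derivative_compose[of c "\<lambda>s. s *\<^sub>R v" 0 UNIV f Df]
    unfolding has_vector_derivative_def by blast
  moreover have "((\<lambda>t. f (c t)) has_derivative (\<lambda>s. 0)) (at 0)"
    by (rule has_derivative_locally_constant[where S = "{-e<..<e}" and a = 0])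
       (use e in \<open>auto simp: zero_set_def image_subset_iff\<close>)
  ultimately have "(\<lambda>s. Df (s *\<^sub>R v)) = (\<lambda>s. 0)"
    by (rule has_derivative_unique)
  from fun_cong[OF this, of 1] show ?thesis by simp
qed

text \<open>With \<open>L = Df x\<close> and a linear right inverse \<open>R\<close> of \<open>L\<close>, the map \<open>G z = z - R (L z) + R (f z)\<close> has derivative
  \<open>id\<close> at \<open>x\<close> and satisfies \<open>L (G z) = f z\<close>. Its local inverse straightens the level set of \<open>f\<close> to the
  kernel of \<open>L\<close>, so the preimage \<open>c\<close> of the line \<open>G x + t v\<close> is a curve in the level set. The inverse
  function theorem only says that \<open>c\<close> is differentiable. For higher orders, differentiating \<open>G (c t)\<close>
  and \<open>f (c t) = 0\<close> shows that \<open>c' = v + R y\<close>, where \<open>y = L c'\<close> solves the square system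
  \<open>Df (c t) (R y) = - Df (c t) v\<close>. By Cramer's rule \<open>y\<close> is a rational expression in functions of the
  form \<open>g (c t)\<close> with \<open>g\<close> smooth, so \<open>c'\<close> is as smooth as \<open>c\<close>.\<close>

lemma kernel_vector_is_tangent:
  fixes f :: "'a::euclidean_space \<Rightarrow> real^'q"
  defines "Df \<equiv> \<lambda>x. frechet_derivative f (at x)"
  assumes f: "smooth_on UNIV f" and x: "f x = 0" and surj: "surj (Df x)" and v: "Df x v = 0"
  shows "v \<in> tangent_space_at (zero_set f) x"
proof -
  have C: "C_k_on k UNIV f" for k
    using f by (simp add: smooth_on_def)
  have der: "(f has_derivative Df z) (at z)" for z
    using C_k_on_SucD(1)[OF C] by (simp add: Df_def)
  have CD: "C_k_on k UNIV (\<lambda>z. Df z u)" for k u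
    unfolding Df_def by (rule C_k_on_SucD(2)[OF C])
  define L where "L = Df x"
  have linL: "linear L" unfolding L_def using der has_derivative_linear by blast
  obtain R where linR: "linear R" and LR: "L \<circ> R = id"
    using linear_surjective_right_inverse[OF linL] surj L_def by blast
  have LR [simp]: "L (R y) = y" for y using LR by (metis comp_apply id_apply)
  note bl = linL[unfolded linear_conv_bounded_linear] linR[unfolded linear_conv_bounded_linear]
  define G where "G z = z - R (L z) + R (f z)" for z
  define G' where "G' z = Blinfun (\<lambda>u. u - R (L u) + R (Df z u))" for z
  have G': "blinfun_apply (G' z) = (\<lambda>u. u - R (L u) + R (Df z u))" for z
    unfolding G'_def
    by (intro bounded_linear_Blinfun_apply bounded_linear_add bounded_linear_sub bounded_linear_ident
        bounded_linear_compose[OF bl(2)] bl(1) has_derivative_bounded_linear[OF der])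
  have derG: "(G has_derivative blinfun_apply (G' z)) (at z)" for z
    unfolding G_def G'
    by (intro has_derivative_add has_derivative_diff has_derivative_ident
        bounded_linear.has_derivative[OF bl(2)] bounded_linear.has_derivative[OF bl(1)] der)
  have contG: "continuous_on UNIV G'"
  proof (rule continuous_on_blinfun_componentwise)
    fix b :: 'a
    have "continuous_on UNIV (\<lambda>z. Df z b)" using CD[of 0 b] by simp
    then show "continuous_on UNIV (\<lambda>z. blinfun_apply (G' z) b)"
      unfolding G' by (intro continuous_intros bounded_linear.continuous_on[OF bl(2)])
  qed
  have "id_blinfun o\<^sub>L G' x = id_blinfun"
    by (rule blinfun_eqI) (simp add: G' L_def)
  then obtain U W g g' where W: "open W" "G x \<in> W" and xU: "x \<in> U" and hom: "homeomorphism U W G g"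
    and g': "\<And>y. y \<in> W \<Longrightarrow> (g has_derivative g' y) (at y)"
    using inverse_function_theorem[OF open_UNIV derG contG UNIV_I] by metis
  define w where "w t = G x + t *\<^sub>R v" for t :: real
  define c where "c t = g (w t)" for t
  define c' where "c' t = g' (w t) v" for t
  have w': "(w has_derivative (\<lambda>s. s *\<^sub>R v)) (at t)" for t
    unfolding w_def by (auto intro!: derivative_eq_intros)
  \<comment> \<open>restrict to times for which the line stays in the domain \<open>W\<close> of the local inverse\<close>
  have "continuous_on UNIV w"
    unfolding w_def by (intro continuous_intros)
  then have "open (w -` W)" by (rule open_vimage[OF W(1)])
  moreover have "0 \<in> w -` W" using W(2) by (simp add: w_def)
  ultimately obtain e0 where e0: "0 < e0" "ball 0 e0 \<subseteq> w -` W"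
    by (rule openE)
  have wW: "w t \<in> W" if "t \<in> ball 0 e0" for t using e0 that by auto
  have c0: "c 0 = x"
    using hom xU by (simp add: c_def w_def homeomorphism_def)
  have Gc: "G (c t) = w t" if "t \<in> ball 0 e0" for t
    using hom wW[OF that] by (auto simp: c_def homeomorphism_def)
  have fc: "f (c t) = 0" if "t \<in> ball 0 e0" for t
  proof -
    have "L (G (c t)) = L (w t)" using Gc[OF that] by simp
    then show ?thesis
      using v x linL by (simp add: G_def w_def L_def[symmetric] linear_add linear_diff linear_scale)
  qed
  \<comment> \<open>the curve leaves the line \<open>x + t v\<close> only in the directions in the range of \<open>R\<close>\<close>
  have cR: "c t = x + t *\<^sub>R v + R (L (c t - x))" if "t \<in> ball 0 e0" for t
    using Gc[OF that] fc[OF that] x linL linR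
    by (simp add: G_def w_def linear_diff algebra_simps linear_0)
  have derc: "(c has_derivative (\<lambda>s. s *\<^sub>R c' t)) (at t)" if "t \<in> ball 0 e0" for t
  proof -
    have "linear (g' (w t))" using g'[OF wW[OF that]] has_derivative_linear by blast
    then show ?thesis
      using has_derivative_compose[OF w' g'[OF wW[OF that]]]
      by (simp add: c_def[abs_def] c'_def linear_scale)
  qed
  have c'R: "c' t = v + R (L (c' t))" if t: "t \<in> ball 0 e0" for t
  proof -
    have "((\<lambda>t. x + t *\<^sub>R v + R (L (c t - x))) has_derivative (\<lambda>s. s *\<^sub>R v + R (L (s *\<^sub>R c' t)))) (at t)"
      by (auto intro!: derivative_eq_intros bounded_linear.has_derivative[OF bl(2)]
          bounded_linear.has_derivative[OF bl(1)] derc[OF t])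
    then have "(c has_derivative (\<lambda>s. s *\<^sub>R v + R (L (s *\<^sub>R c' t)))) (at t)"
      by (rule has_derivative_transform_within_open[OF _ open_ball t]) (simp add: cR[symmetric])
    with derc[OF t] have "(\<lambda>s. s *\<^sub>R c' t) = (\<lambda>s. s *\<^sub>R v + R (L (s *\<^sub>R c' t)))"
      by (rule has_derivative_unique)
    from fun_cong[OF this, of 1] show ?thesis by simp
  qed
  have Dfc': "Df (c t) (c' t) = 0" if t: "t \<in> ball 0 e0" for t
  proof -
    have "((\<lambda>t. f (c t)) has_derivative (\<lambda>s. Df (c t) (s *\<^sub>R c' t))) (at t)"
      by (rule has_derivative_compose[OF derc[OF t] der])
    moreover have "((\<lambda>t. f (c t)) has_derivative (\<lambda>s. 0)) (at t)"
      by (rule has_derivative_locally_constant[OF open_ball t fc])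
    ultimately have "(\<lambda>s. Df (c t) (s *\<^sub>R c' t)) = (\<lambda>s. 0)"
      by (rule has_derivative_unique)
    from fun_cong[OF this, of 1] show ?thesis by simp
  qed
  define M where "M t = matrix (\<lambda>y. Df (c t) (R y))" for t
  have M: "M t *v y = Df (c t) (R y)" for t y
    unfolding M_def
    using matrix_works[of "\<lambda>y. Df (c t) (R y)"] linear_compose[OF linR has_derivative_linear[OF der]]
    by (simp add: o_def linear_matrix_vector_mul_eq)
  have sys: "M t *v L (c' t) = - Df (c t) v" if t: "t \<in> ball 0 e0" for t
  proof -
    have "0 = Df (c t) (v + R (L (c' t)))" using Dfc'[OF t] c'R[OF t] by simp
    also have "\<dots> = Df (c t) v + M t *v L (c' t)"
      by (simp add: M linear_add[OF has_derivative_linear[OF der]])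
    finally show ?thesis by (simp add: eq_neg_iff_add_eq_0 add.commute)
  qed
  have Ment: "C_k_on k S (\<lambda>t. M t $ i $ j)" if "open S" "C_k_on k S c" for k S i j
  proof -
    have "C_k_on k S (\<lambda>t. Df (c t) (R (axis j 1)))"
      by (rule C_k_on_compose[OF that(1) CD that(2)]) simp
    then have "C_k_on k S (\<lambda>t. Df (c t) (R (axis j 1)) \<bullet> axis i 1)"
      by (intro C_k_on_bilinear[OF bounded_bilinear_inner] that C_k_on_const)
    then show ?thesis by (simp add: M_def matrix_def inner_axis)
  qed
  \<comment> \<open>\<open>M 0\<close> is the identity, so Cramer's rule applies for all sufficiently small times\<close>
  have cont: "C_k_on 0 (ball 0 e0) c"
    unfolding C_k_on.simps
    by (intro continuous_at_imp_continuous_on ballI has_derivative_continuous[OF derc])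
  have "continuous_on (ball 0 e0) (\<lambda>t. det (M t))"
    using C_k_on_det[OF open_ball Ment[OF open_ball cont]] by simp
  then have "open (ball 0 e0 \<inter> (\<lambda>t. det (M t)) -` (- {0}))"
    by (rule continuous_open_preimage) auto
  moreover have "M 0 = mat 1"
    by (simp add: M_def c0 L_def[symmetric] matrix_id_mat_1[unfolded id_def])
  then have "0 \<in> ball 0 e0 \<inter> (\<lambda>t. det (M t)) -` (- {0})" using e0(1) by simp
  ultimately obtain e where e: "0 < e" "ball 0 e \<subseteq> ball 0 e0 \<inter> (\<lambda>t. det (M t)) -` (- {0})"
    by (rule openE)
  have c'eq: "c' t = v + (\<Sum>k\<in>UNIV. (det (\<chi> i j. if j = k then - (Df (c t) v $ i) else M t $ i $ j) *
      inverse (det (M t))) *\<^sub>R R (axis k 1))" if t: "t \<in> ball 0 e" for t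
  proof -
    have t0: "t \<in> ball 0 e0" and dt: "det (M t) \<noteq> 0" using e t by auto
    define y where "y = (\<chi> k. det (\<chi> i j. if j = k then - (Df (c t) v $ i) else M t $ i $ j) *
      inverse (det (M t)))"
    have "L (c' t) = y"
      using iffD1[OF cramer[OF dt] sys[OF t0]]
      by (simp only: y_def divide_inverse vector_uminus_component)
    then have "c' t = v + R (\<Sum>k\<in>UNIV. (y $ k) *\<^sub>R axis k 1)"
      using c'R[OF t0] basis_expansion[of y] by (simp add: scalar_mult_eq_scaleR)
    then show ?thesis
      by (simp add: linear_sum[OF linR] linear_scale[OF linR] y_def)
  qed
  \<comment> \<open>bootstrap: the right-hand side of \<open>c'eq\<close> is built from \<open>c\<close> by operations that preserve \<open>C\<^sup>k\<close>\<close>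
  have "C_k_on k (ball 0 e) c" for k
  proof (induction k)
    case 0
    show ?case using cont e(2) by (auto intro: continuous_on_subset)
  next
    case (Suc k)
    have Ment': "C_k_on k (ball 0 e) (\<lambda>t. M t $ i $ j)" for i j
      by (rule Ment[OF open_ball Suc])
    have neg: "C_k_on k (ball 0 e) (\<lambda>t. - (Df (c t) v $ i))" for i
    proof -
      have "C_k_on k (ball 0 e) (\<lambda>t. Df (c t) v \<bullet> (- axis i 1))"
        by (intro C_k_on_bilinear[OF bounded_bilinear_inner] open_ball C_k_on_const
            C_k_on_compose[OF _ CD Suc]) simp
      then show ?thesis by (simp add: inner_axis)
    qed
    have "C_k_on k (ball 0 e) (\<lambda>t. v + (\<Sum>k\<in>UNIV.
        (det (\<chi> i j. if j = k then - (Df (c t) v $ i) else M t $ i $ j) * inverse (det (M t))) *\<^sub>R R (axis k 1)))"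
    proof (intro C_k_on_add C_k_on_sum C_k_on_scaleR C_k_on_mult C_k_on_inverse C_k_on_const open_ball)
      show "C_k_on k (ball 0 e) (\<lambda>t. det (M t))"
        by (intro C_k_on_det open_ball Ment')
      show "C_k_on k (ball 0 e) (\<lambda>t. det (\<chi> i j. if j = l then - (Df (c t) v $ i) else M t $ i $ j))" for l
      proof (intro C_k_on_det open_ball)
        show "C_k_on k (ball 0 e)
          (\<lambda>t. (\<chi> i j. if j = l then - (Df (c t) v $ i) else M t $ i $ j) $ i $ j)" for i j
          using neg Ment' by (cases "j = l") auto
      qed
    qed (use e(2) in auto)
    then have c'C: "C_k_on k (ball 0 e) c'"
      by (rule C_k_on_cong[OF _ open_ball]) (simp add: c'eq)
    show ?case
    proof (rule C_k_on_SucI[OF open_ball])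
      show "(c has_derivative (\<lambda>s. s *\<^sub>R c' t)) (at t)" if "t \<in> ball 0 e" for t
        using derc e(2) that by auto
      show "C_k_on k (ball 0 e) (\<lambda>t. s *\<^sub>R c' t)" for s
        by (intro C_k_on_scaleR C_k_on_const open_ball c'C)
    qed
  qed
  then have "smooth_on {-e<..<e} c"
    by (simp add: smooth_on_def ball_eq_greaterThanLessThan)
  moreover have "c ` {-e<..<e} \<subseteq> zero_set f"
    using fc e(2) by (auto simp: zero_set_def ball_eq_greaterThanLessThan)
  moreover have "c' 0 = v"
    using Dfc'[of 0] c'R[of 0] e0(1) c0 linear_0[OF linR] by (simp add: L_def)
  then have "(c has_vector_derivative v) (at 0)"
    using derc[of 0] e0(1) by (simp add: has_vector_derivative_def)
  ultimately show ?thesis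
    unfolding tangent_space_at_def using e(1) c0 by blast
qed

lemma tangent_space_zero_set:
  fixes f :: "'a::euclidean_space \<Rightarrow> real^'q"
  assumes "smooth_on UNIV f" "f x = 0" "surj (frechet_derivative f (at x))"
  shows "tangent_space_at (zero_set f) x = {v. frechet_derivative f (at x) v = 0}"
proof -
  have f': "(f has_derivative frechet_derivative f (at x)) (at x)"
    by (rule smooth_on_has_derivative[OF assms(1) UNIV_I])
  show ?thesis
    using tangent_vector_in_kernel[OF f'] kernel_vector_is_tangent[OF assms] by (intro equalityI subsetI) simp_all
qed

section \<open>Stiefel matrices\<close>

lemma linear_mult_right: "linear (\<lambda>Y::real^'n^'m. Y ** (A::real^'k^'n))"
  by (rule linearI)
     (auto simp: vec_eq_iff matrix_matrix_mult_def sum.distrib distrib_right sum_distrib_left mult.assoc)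

lemma linear_mult_left: "linear (\<lambda>A::real^'k^'n. (Y::real^'n^'m) ** A)"
  by (rule linearI)
     (auto simp: vec_eq_iff matrix_matrix_mult_def sum.distrib distrib_left sum_distrib_left mult_ac)

lemma trace_transpose_mult_eq_inner: "trace (transpose A ** B) = (A::real^'n^'m) \<bullet> B"
  unfolding trace_def matrix_matrix_mult_def transpose_def inner_vec_def
  by (simp, subst sum.swap) simp

text \<open>Right multiplication by \<open>V\<close> and by \<open>V\<^sup>T\<close> are adjoint to each other; this is what carries normal vectors
  from one level set to the other.\<close>

lemma inner_mult_right:
  fixes Y :: "real^'n^'m" and N :: "real^'s^'m" and V :: "real^'s^'n"
  shows "(N ** transpose V) \<bullet> Y = N \<bullet> (Y ** V)"
proof -
  have "(N ** transpose V) \<bullet> Y = (\<Sum>i\<in>UNIV. \<Sum>j\<in>UNIV. \<Sum>k\<in>UNIV. N$i$k * V$j$k * Y$i$j)"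
    by (simp add: inner_vec_def matrix_matrix_mult_def transpose_def sum_distrib_right)
  also have "\<dots> = (\<Sum>i\<in>UNIV. \<Sum>k\<in>UNIV. \<Sum>j\<in>UNIV. N$i$k * V$j$k * Y$i$j)"
    by (intro sum.cong refl sum.swap)
  also have "\<dots> = N \<bullet> (Y ** V)"
    by (simp add: inner_vec_def matrix_matrix_mult_def sum_distrib_left mult_ac)
  finally show ?thesis .
qed

lemma inner_matrix_vector_mult: "(A *v x) \<bullet> y = x \<bullet> (transpose A *v y)" for A :: "real^'n^'m"
  by (metis dot_lmul_matrix inner_commute transpose_matrix_vector)

lemma mult_Stiefel_cancel:
  assumes "V \<in> Stiefel"
  shows "(K ** transpose V) ** V = K"
  using assms by (simp add: Stiefel_def matrix_mul_assoc[symmetric])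

lemma transpose_Stiefel_mult_vec: "V \<in> Stiefel \<Longrightarrow> transpose V *v (V *v z) = z"
  unfolding Stiefel_def matrix_vector_mul_assoc by (simp del: transpose_matrix_vector)

text \<open>\<open>V V\<^sup>T\<close> is the orthogonal projection onto the range of \<open>V\<close>, so this matrix is the reflection that
  fixes the range and negates its orthogonal complement.\<close>

lemma reflection_orthogonal:
  fixes V :: "real^'s^'n"
  assumes "V \<in> Stiefel"
  shows "orthogonal_matrix (2 *\<^sub>R (V ** transpose V) - mat 1)"
proof -
  let ?P = "V ** transpose V"
  have PP: "?P ** ?P = ?P"
    using mult_Stiefel_cancel[OF assms, of V] by (simp add: matrix_mul_assoc)
  have PT: "transpose ?P = ?P"
    by (simp add: matrix_transpose_mul)
  have tr: "transpose (2 *\<^sub>R ?P - mat 1) = 2 *\<^sub>R ?P - mat 1"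
    using PT by (simp add: vec_eq_iff transpose_def mat_def)
  have R: "(2 *\<^sub>R ?P - mat 1) *v z = 2 *\<^sub>R (?P *v z) - z" for z
    by (simp add: matrix_vector_mult_diff_rdistrib flip: scaleR_matrix_vector_assoc)
  have PPv: "?P *v (?P *v z) = ?P *v z" for z
    by (simp only: matrix_vector_mul_assoc PP)
  have "(2 *\<^sub>R ?P - mat 1) *v ((2 *\<^sub>R ?P - mat 1) *v z) = z" for z
    unfolding R by (simp only: matrix_vector_mult_diff_distrib matrix_vector_mult_scaleR PPv)
      (simp only: scaleR_2 algebra_simps)
  then have "(2 *\<^sub>R ?P - mat 1) ** (2 *\<^sub>R ?P - mat 1) = mat 1"
    by (simp only: matrix_eq matrix_vector_mul_lid matrix_vector_mul_assoc[symmetric] simp_thms)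
  then show ?thesis
    by (simp add: orthogonal_matrix tr)
qed

text \<open>The map \<open>V z \<mapsto> W z\<close> is an isometry between the ranges of \<open>V\<close> and \<open>W\<close>. Their orthogonal complements
  have equal dimension and are thus isometric too; the two isometries together form \<open>Q\<close>.\<close>

lemma Stiefel_transitive:
  fixes V W :: "real^'s^'n"
  assumes V: "V \<in> Stiefel" and W: "W \<in> Stiefel"
  obtains Q where "orthogonal_matrix Q" "W = Q ** V"
proof -
  have norm_St: "norm (A *v z) = norm z" if "A \<in> Stiefel" for A :: "real^'s^'n" and z
    unfolding norm_eq_sqrt_inner inner_matrix_vector_mult transpose_Stiefel_mult_vec[OF that] ..
  have dim_St: "dim {y. \<forall>x\<in>range ((*v) A). orthogonal x y} + CARD('s) = CARD('n)"
    if "A \<in> Stiefel" for A :: "real^'s^'n"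
  proof -
    have "inj ((*v) A)"
      by (rule inj_on_inverseI[where g = "(*v) (transpose A)"]) (rule transpose_Stiefel_mult_vec[OF that])
    then have "dim (range ((*v) A)) = CARD('s)"
      using dim_image_eq[OF matrix_vector_mul_linear[of A], of UNIV] by simp
    moreover have "subspace (range ((*v) A))"
      by (rule linear_subspace_image[OF matrix_vector_mul_linear subspace_UNIV])
    ultimately show ?thesis
      using dim_subspace_orthogonal_to_vectors[of "range ((*v) A)" UNIV] by simp
  qed
  define S where "S A = {y. \<forall>x\<in>range ((*v) A). orthogonal x y}" for A :: "real^'s^'n"
  have sub: "subspace (S A)" for A :: "real^'s^'n"
    unfolding S_def by (rule subspace_orthogonal_to_vectors)
  obtain f where f: "linear f" "f ` S V = S W" "\<And>x. x \<in> S V \<Longrightarrow> norm (f x) = norm x"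
  proof (rule isometries_subspaces[OF sub sub])
    show "dim (S V) = dim (S W)"
      using dim_St[OF V] dim_St[OF W] unfolding S_def by linarith
  qed blast
  \<comment> \<open>\<open>V\<^sup>T z\<close> gives the coordinates of the part of \<open>z\<close> in the range of \<open>V\<close>, and \<open>p z\<close> is the rest\<close>
  define p where "p z = z - V *v (transpose V *v z)" for z
  have p: "p z \<in> S V" for z
    unfolding S_def p_def
    by (auto simp: orthogonal_def inner_matrix_vector_mult matrix_vector_mult_diff_distrib
        transpose_Stiefel_mult_vec[OF V] simp del: transpose_matrix_vector)
  have linp: "linear p"
    unfolding p_def by (intro linear_compose_sub linear_ident linear_compose[OF matrix_vector_mul_linear matrix_vector_mul_linear, unfolded o_def])
  define F where "F z = W *v (transpose V *v z) + f (p z)" for z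
  have "norm (F z) = norm z" for z
  proof -
    have "f (p z) \<in> S W" using p f(2) by blast
    then have "(norm (F z))\<^sup>2 = (norm (W *v (transpose V *v z)))\<^sup>2 + (norm (f (p z)))\<^sup>2"
      unfolding F_def by (intro norm_add_Pythagorean) (auto simp: S_def)
    also have "\<dots> = (norm (V *v (transpose V *v z)))\<^sup>2 + (norm (p z))\<^sup>2"
      using f(3) p norm_St V W by simp
    also have "\<dots> = (norm (V *v (transpose V *v z) + p z))\<^sup>2"
      using p[of z] by (intro norm_add_Pythagorean[symmetric]) (auto simp: S_def)
    finally show ?thesis by (simp add: p_def)
  qed
  moreover have linF: "linear F"
    unfolding F_def by (intro linear_compose_add linear_compose[OF matrix_vector_mul_linear matrix_vector_mul_linear, unfolded o_def] linear_compose[OF linp f(1), unfolded o_def])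
  ultimately have Q: "orthogonal_matrix (matrix F)"
    using orthogonal_transformation_matrix[of F] by (simp add: orthogonal_transformation)
  have "W *v z = (matrix F ** V) *v z" for z
  proof -
    have "p (V *v z) = 0"
      by (simp add: p_def transpose_Stiefel_mult_vec[OF V] del: transpose_matrix_vector)
    then have "W *v z = F (V *v z)"
      by (simp add: F_def linear_0[OF f(1)] transpose_Stiefel_mult_vec[OF V] del: transpose_matrix_vector)
    also have "\<dots> = (matrix F ** V) *v z"
      by (simp add: matrix_works[OF linF[folded linear_matrix_vector_mul_eq]] flip: matrix_vector_mul_assoc)
    finally show ?thesis .
  qed
  then have "W = matrix F ** V" by (simp add: matrix_eq)
  with Q show ?thesis by (rule that)
qed

section \<open>Block matrices and zero padding\<close>

lemma bij_betw_card_lessThan: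
  "bij_betw (\<lambda>j::'n::{finite,linorder}. card {..<j}) UNIV {..<CARD('n)}"
proof -
  have "inj (\<lambda>j::'n. card {..<j})"
  proof (rule linorder_injI)
    fix x y :: 'n assume "x < y"
    then have "{..<x} \<subset> {..<y}" by auto
    then have "card {..<x} < card {..<y}" by (simp add: psubset_card_mono)
    then show "card {..<x} \<noteq> card {..<y}" by simp
  qed
  moreover have "card {..<j} < CARD('n)" for j :: 'n
    by (rule psubset_card_mono) auto
  ultimately show ?thesis
    by (intro bij_betw_imageI card_subset_eq) (auto simp: card_image)
qed

text \<open>Summing over the columns of a block matrix amounts to summing over its two blocks: positions number
  the columns bijectively, and the first positions enumerate the column indices of the left block.\<close>

lemma sum_hcat_columns:
  fixes F :: "'s::{finite,linorder} \<Rightarrow> real" and G :: "nat \<Rightarrow> real"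
  assumes "CARD('s) \<le> CARD('n::{finite,linorder})"
  shows "(\<Sum>j\<in>(UNIV::'n set). if card {..<j} < CARD('s) then F (sorted_list_of_set UNIV ! card {..<j})
            else G (card {..<j} - CARD('s))) =
         (\<Sum>k\<in>UNIV. F k) + (\<Sum>l<CARD('n) - CARD('s). G l)"
proof -
  let ?F = "\<lambda>p. F (sorted_list_of_set UNIV ! p)"
  have split: "(\<Sum>p<s + d. if p < s then ?F p else G (p - s)) = (\<Sum>p<s. ?F p) + (\<Sum>l<d. G l)" for s d :: nat
    by (induction d) auto
  have "(\<Sum>j\<in>(UNIV::'n set). if card {..<j} < CARD('s) then ?F (card {..<j})
            else G (card {..<j} - CARD('s))) =
        (\<Sum>p<CARD('n). if p < CARD('s) then ?F p else G (p - CARD('s)))"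
    by (rule sum.reindex_bij_betw[OF bij_betw_card_lessThan])
  also have "\<dots> = (\<Sum>p<CARD('s). ?F p) + (\<Sum>l<CARD('n) - CARD('s). G l)"
    using split[of "CARD('s)" "CARD('n) - CARD('s)"] assms by simp
  also have "(\<Sum>p<CARD('s). ?F p) = (\<Sum>k\<in>UNIV. F k)"
    by (rule sum.reindex_bij_betw[OF bij_betw_nth]) auto
  finally show ?thesis .
qed

lemma hcat_mult_transpose_hcat:
  fixes A :: "real^'s::{finite,linorder}^'m" and A' :: "real^'s::{finite,linorder}^'k"
  assumes "CARD('s) \<le> CARD('n::{finite,linorder})"
  shows "(hcat A C :: real^'n::{finite,linorder}^'m) ** transpose (hcat A' C') =
         A ** transpose A' + cols_mult_transpose (CARD('n) - CARD('s)) C C'"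
proof -
  have "((hcat A C :: real^'n::{finite,linorder}^'m) ** transpose (hcat A' C')) $ i $ i' =
    (\<Sum>k\<in>UNIV. A $ i $ k * A' $ i' $ k) + (\<Sum>l<CARD('n) - CARD('s). C l $ i * C' l $ i')" for i i'
    unfolding sum_hcat_columns[OF assms, symmetric]
    by (auto simp: matrix_matrix_mult_def transpose_def hcat_def Let_def intro!: sum.cong)
  then show ?thesis
    by (simp add: vec_eq_iff matrix_matrix_mult_def transpose_def cols_mult_transpose_def)
qed

text \<open>Zero padding is right multiplication by the block matrix \<open>[I 0]\<close>, whose transpose is a Stiefel
  matrix. This makes zero padding linear, and puts it on the same footing as \<open>K \<mapsto> K V\<^sup>T\<close>.\<close>

lemma hcat_zero_eq_mult:
  "(hcat K (\<lambda>_. 0) :: real^'n::{finite,linorder}^'m) = K ** hcat (mat 1 :: real^'s::{finite,linorder}^'s::{finite,linorder}) (\<lambda>_. 0)"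
  by (simp add: vec_eq_iff hcat_def Let_def matrix_matrix_mult_def mat_def mult_delta_right)

lemma standard_Stiefel:
  assumes "CARD('s::{finite,linorder}) \<le> CARD('n::{finite,linorder})"
  shows "transpose (hcat (mat 1 :: real^'s::{finite,linorder}^'s::{finite,linorder}) (\<lambda>_. 0) :: real^'n::{finite,linorder}^'s::{finite,linorder}) \<in> Stiefel"
  using hcat_mult_transpose_hcat[OF assms, of "mat 1 :: real^'s::{finite,linorder}^'s::{finite,linorder}" "\<lambda>_. 0" "mat 1 :: real^'s::{finite,linorder}^'s::{finite,linorder}" "\<lambda>_. 0"]
  by (simp add: Stiefel_def cols_mult_transpose_def vec_eq_iff transpose_mat)

text \<open>If \<open>V = Q [I 0]\<^sup>T\<close> with \<open>Q\<close> orthogonal, then \<open>K V\<^sup>T = [K 0] Q\<^sup>T\<close>.\<close>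

lemma invariant_at_Stiefel:
  fixes h :: "real^'n::{finite,linorder}^'m \<Rightarrow> 'b" and V :: "real^'s::{finite,linorder}^'n::{finite,linorder}"
  assumes inv: "\<And>Y Q. orthogonal_matrix Q \<Longrightarrow> h (Y ** Q) = h Y"
    and card: "CARD('s) \<le> CARD('n)" and V: "V \<in> Stiefel"
  shows "h (K ** transpose V) = zero_pad_restr h K"
proof -
  let ?J = "hcat (mat 1 :: real^'s::{finite,linorder}^'s::{finite,linorder}) (\<lambda>_. 0) :: real^'n::{finite,linorder}^'s::{finite,linorder}"
  obtain Q where Q: "orthogonal_matrix Q" "V = Q ** transpose ?J"
    by (rule Stiefel_transitive[OF standard_Stiefel[OF card] V])
  then have "K ** transpose V = hcat K (\<lambda>_. 0) ** transpose Q"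
    by (simp add: matrix_transpose_mul matrix_mul_assoc hcat_zero_eq_mult[of K])
  then show ?thesis
    using inv[of "transpose Q" "hcat K (\<lambda>_. 0)"] Q(1) by (simp add: zero_pad_restr_def)
qed

lemma cols_mult_transpose_mult:
  "(cols_mult_transpose k B C ** V) $ i $ j = (\<Sum>l<k. B l $ i * (C l \<bullet> column j V))"
  unfolding cols_mult_transpose_def matrix_matrix_mult_def column_def inner_vec_def
  by (simp add: sum_distrib_left sum_distrib_right mult.assoc) (rule sum.swap)

lemma mult_cols_mult_transpose:
  "Y ** cols_mult_transpose k B C = cols_mult_transpose k (\<lambda>l. Y *v B l) C"
  unfolding cols_mult_transpose_def matrix_matrix_mult_def matrix_vector_mult_def vec_eq_iff
  by (auto simp add: sum_distrib_left sum_distrib_right mult.assoc intro: sum.swap)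

text \<open>Orthogonality of \<open>[V V\<^sub>\<bottom>]\<close> says \<open>V V\<^sup>T + V\<^sub>\<bottom> V\<^sub>\<bottom>\<^sup>T = I\<close>. Multiplying \<open>Y\<close> with \<open>Y V = 0\<close> by this identity gives
  \<open>Y = (Y V\<^sub>\<bottom>) V\<^sub>\<bottom>\<^sup>T\<close>. Conversely, multiplying the identity by \<open>V\<close> gives \<open>V\<^sub>\<bottom> V\<^sub>\<bottom>\<^sup>T V = 0\<close>, which forces the columns
  of \<open>V\<^sub>\<bottom>\<close> to be orthogonal to those of \<open>V\<close>.\<close>

lemma orthogonal_completion_image:
  fixes V :: "real^'s::{finite,linorder}^'n::{finite,linorder}" and Vp :: "nat \<Rightarrow> real^'n::{finite,linorder}"
  assumes card: "CARD('s) \<le> CARD('n)" and V: "V \<in> Stiefel"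
    and Vp: "orthogonal_matrix (hcat V Vp :: real^'n::{finite,linorder}^'n::{finite,linorder})"
  shows "(\<lambda>B. cols_mult_transpose (CARD('n) - CARD('s)) B Vp) ` col_mats (CARD('n) - CARD('s)) =
         {Y :: real^'n::{finite,linorder}^'m. Y ** V = 0}"
proof -
  let ?d = "CARD('n) - CARD('s)"
  have one: "V ** transpose V + cols_mult_transpose ?d Vp Vp = mat 1"
    using Vp hcat_mult_transpose_hcat[OF card, of V Vp V Vp] by (simp add: orthogonal_matrix_def)
  have "V + cols_mult_transpose ?d Vp Vp ** V = V"
    using arg_cong[OF one, of "\<lambda>A. A ** V"]
    by (simp add: linear_add[OF linear_mult_right] mult_Stiefel_cancel[OF V])
  then have zero: "cols_mult_transpose ?d Vp Vp ** V = 0" by simp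
  have orth: "Vp l \<bullet> column k V = 0" if "l < ?d" for l k
  proof -
    \<comment> \<open>the squared norm of \<open>V\<^sub>\<bottom>\<^sup>T v\<close>, for a column \<open>v\<close> of \<open>V\<close>, equals \<open>v\<^sup>T V\<^sub>\<bottom> V\<^sub>\<bottom>\<^sup>T v\<close>\<close>
    have "(\<Sum>l<?d. (Vp l \<bullet> column k V)\<^sup>2) =
      (\<Sum>l<?d. \<Sum>j\<in>UNIV. V $ j $ k * (Vp l $ j * (Vp l \<bullet> column k V)))"
      by (simp add: power2_eq_square inner_vec_def column_def sum_distrib_right sum_distrib_left mult_ac)
    also have "\<dots> = (\<Sum>j\<in>UNIV. V $ j $ k * (cols_mult_transpose ?d Vp Vp ** V) $ j $ k)"
      unfolding cols_mult_transpose_mult sum_distrib_left by (rule sum.swap)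
    also have "\<dots> = 0" by (simp add: zero)
    finally show ?thesis
      using that by (simp add: sum_nonneg_eq_0_iff)
  qed
  have "cols_mult_transpose ?d B Vp ** V = 0" for B :: "nat \<Rightarrow> real^'m"
    unfolding vec_eq_iff cols_mult_transpose_mult by (simp add: orth)
  moreover have "Y \<in> (\<lambda>B. cols_mult_transpose ?d B Vp) ` col_mats ?d" if Y: "Y ** V = 0" for Y :: "real^'n::{finite,linorder}^'m"
  proof (rule image_eqI)
    \<comment> \<open>membership in \<open>col_mats\<close> requires zeros beyond the last column\<close>
    let ?B = "\<lambda>l. if l < ?d then Y *v Vp l else 0"
    have "Y = Y ** (V ** transpose V + cols_mult_transpose ?d Vp Vp)"
      by (simp add: one)
    also have "\<dots> = cols_mult_transpose ?d (\<lambda>l. Y *v Vp l) Vp"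
      by (simp add: matrix_add_ldistrib matrix_mul_assoc Y mult_cols_mult_transpose)
    also have "\<dots> = cols_mult_transpose ?d ?B Vp"
      by (simp add: cols_mult_transpose_def)
    finally show "Y = cols_mult_transpose ?d ?B Vp" .
    show "?B \<in> col_mats ?d" by (simp add: col_mats_def)
  qed
  ultimately show ?thesis by auto
qed

section \<open>Linear algebra of the direct sum and of the normal space\<close>

text \<open>The summands of \<open>Y\<close> are \<open>Y V V\<^sup>T\<close> and \<open>Y - Y V V\<^sup>T\<close>; since \<open>V\<^sup>T V = I\<close>, right multiplication by \<open>V\<close> sends the
  first to \<open>Y V\<close> and the second to \<open>0\<close>.\<close>

lemma direct_sum_of_preimage:
  fixes V :: "real^'s^'n" and T :: "(real^'s^'m) set"
  assumes V: "V \<in> Stiefel" and T: "subspace T"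
  shows "is_direct_sum {Y. Y ** V \<in> T} ((\<lambda>K. K ** transpose V) ` T) {Y. Y ** V = 0}"
  unfolding is_direct_sum_def
proof (intro conjI)
  show "subspace ((\<lambda>K. K ** transpose V) ` T)"
    by (rule linear_subspace_image[OF linear_mult_right T])
  show "subspace {Y :: real^'n^'m. Y ** V = 0}"
    by (rule linear_subspace_kernel[OF linear_mult_right])
  show "{Y. Y ** V \<in> T} = {a + b |a b. a \<in> (\<lambda>K. K ** transpose V) ` T \<and> b \<in> {Y. Y ** V = 0}}"
    (is "_ = ?R")
  proof (intro equalityI subsetI)
    fix Y :: "real^'n^'m" assume "Y \<in> {Y. Y ** V \<in> T}"
    moreover have "Y = Y ** V ** transpose V + (Y - Y ** V ** transpose V)" by simp
    moreover have "(Y - Y ** V ** transpose V) ** V = 0"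
      by (simp add: linear_diff[OF linear_mult_right] mult_Stiefel_cancel[OF V])
    ultimately show "Y \<in> ?R" by blast
  next
    fix Y assume "Y \<in> ?R"
    then show "Y \<in> {Y. Y ** V \<in> T}"
      by (auto simp: linear_add[OF linear_mult_right] mult_Stiefel_cancel[OF V])
  qed
  show "(\<lambda>K. K ** transpose V) ` T \<inter> {Y. Y ** V = 0} = {0}"
    using subspace_0[OF T] linear_0[OF linear_mult_right, of "transpose V"] linear_0[OF linear_mult_right, of V]
    by (auto simp: mult_Stiefel_cancel[OF V] image_iff intro!: bexI[of _ 0])
qed

text \<open>A normal vector \<open>A\<close> at \<open>X\<close> is orthogonal to its own component \<open>A - A V V\<^sup>T\<close>, because that component is
  annihilated by \<open>V\<close> and hence tangent. It follows that \<open>A = (A V) V\<^sup>T\<close>, and adjointness moves the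
  orthogonality relations between \<open>A\<close> and \<open>A V\<close>.\<close>

lemma normal_space_of_preimage:
  fixes V :: "real^'s^'n" and M :: "(real^'n^'m) set" and N :: "(real^'s^'m) set"
  assumes V: "V \<in> Stiefel"
    and T: "tangent_space_at M X = {Y. Y ** V \<in> tangent_space_at N H}"
    and zero: "0 \<in> tangent_space_at N H"
  shows "normal_space_at M X = (\<lambda>A. A ** transpose V) ` normal_space_at N H"
proof (intro equalityI subsetI)
  fix A assume "A \<in> normal_space_at M X"
  then have A: "A \<bullet> Y = 0" if "Y ** V \<in> tangent_space_at N H" for Y
    using that by (simp add: normal_space_at_def trace_transpose_mult_eq_inner T)
  \<comment> \<open>\<open>A ** V ** transpose V\<close> is orthogonal to \<open>?Y\<close> as well, so \<open>?Y\<close> is orthogonal to itself\<close>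
  let ?Y = "A - A ** V ** transpose V"
  have Y: "?Y ** V = 0"
    by (simp add: linear_diff[OF linear_mult_right] mult_Stiefel_cancel[OF V])
  have "?Y \<bullet> ?Y = A \<bullet> ?Y - (A ** V ** transpose V) \<bullet> ?Y"
    by (rule inner_diff_left)
  also have "\<dots> = 0"
    using A[of ?Y] Y zero by (simp add: inner_mult_right)
  finally have "A = A ** V ** transpose V" by simp
  moreover have "A ** V \<in> normal_space_at N H"
    unfolding normal_space_at_def trace_transpose_mult_eq_inner
  proof (safe)
    fix K assume "K \<in> tangent_space_at N H"
    then have "A \<bullet> (K ** transpose V) = 0"
      by (intro A) (simp add: mult_Stiefel_cancel[OF V])
    then show "(A ** V) \<bullet> K = 0"
      using inner_mult_right[of K V A] by (simp add: inner_commute)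
  qed
  ultimately show "A \<in> (\<lambda>A. A ** transpose V) ` normal_space_at N H" by blast
next
  fix A assume "A \<in> (\<lambda>A. A ** transpose V) ` normal_space_at N H"
  then show "A \<in> normal_space_at M X"
    by (auto simp: normal_space_at_def trace_transpose_mult_eq_inner T inner_mult_right)
qed

section \<open>Orthogonally invariant maps\<close>

text \<open>Both parts exploit that a function and its composition with a symmetry have the same derivative. The
  first uses \<open>h (K V\<^sup>T) = h\<^sup>s K\<close>. For the second, the reflection \<open>S = 2 V V\<^sup>T - I\<close> fixes the base point, so
  \<open>D Y = D (Y S) = 2 D (Y V V\<^sup>T) - D Y\<close>.\<close>

lemma derivative_of_invariant:
  fixes h :: "real^'n::{finite,linorder}^'m \<Rightarrow> 'b::real_normed_vector"
    and V :: "real^'s::{finite,linorder}^'n::{finite,linorder}"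
  assumes inv: "\<And>Y Q. orthogonal_matrix Q \<Longrightarrow> h (Y ** Q) = h Y"
    and card: "CARD('s) \<le> CARD('n)" and V: "V \<in> Stiefel"
    and D: "(h has_derivative D) (at (H ** transpose V))"
  shows "(zero_pad_restr h has_derivative (\<lambda>K. D (K ** transpose V))) (at H)"
    and "D Y = D (Y ** V ** transpose V)"
proof -
  have der_mult: "((\<lambda>Z. Z ** A) has_derivative (\<lambda>Z. Z ** A)) (at Z)"
    for A :: "real^'k^'l" and Z :: "real^'l^'m"
    by (intro bounded_linear_imp_has_derivative linear_mult_right[unfolded linear_conv_bounded_linear])
  have "zero_pad_restr h = (\<lambda>K. h (K ** transpose V))"
    using invariant_at_Stiefel[OF inv card V] by auto
  then show "(zero_pad_restr h has_derivative (\<lambda>K. D (K ** transpose V))) (at H)"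
    using has_derivative_compose[OF der_mult D] by simp
  let ?X = "H ** transpose V" and ?S = "2 *\<^sub>R (V ** transpose V) - mat 1"
  have S: "Z ** ?S = 2 *\<^sub>R (Z ** V ** transpose V) - Z" for Z :: "real^'n::{finite,linorder}^'m"
    by (simp add: linear_diff[OF linear_mult_left] linear_scale[OF linear_mult_left] matrix_mul_assoc)
  have "?X ** ?S = ?X"
    unfolding S mult_Stiefel_cancel[OF V] by (simp add: scaleR_2)
  then have "((\<lambda>Z. h (Z ** ?S)) has_derivative (\<lambda>Z. D (Z ** ?S))) (at ?X)"
    using has_derivative_compose[OF der_mult[of ?S ?X], of h D] D by simp
  then have "(h has_derivative (\<lambda>Z. D (Z ** ?S))) (at ?X)"
    by (simp add: inv[OF reflection_orthogonal[OF V]])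
  then have refl: "D (Z ** ?S) = D Z" for Z
    using has_derivative_unique[OF D] by metis
  have linD: "linear D" using D by (rule has_derivative_linear)
  have "2 *\<^sub>R D (Y ** V ** transpose V) - D Y = D Y"
    using refl[of Y] unfolding S linear_diff[OF linD] linear_scale[OF linD] .
  then have "2 *\<^sub>R D (Y ** V ** transpose V) = 2 *\<^sub>R D Y"
    by (simp add: scaleR_2 algebra_simps)
  then show "D Y = D (Y ** V ** transpose V)" by simp
qed

lemma smooth_zero_pad_restr:
  fixes h :: "real^'n::{finite,linorder}^'m \<Rightarrow> 'b::real_normed_vector"
  assumes "smooth_on UNIV h"
  shows "smooth_on UNIV (zero_pad_restr h :: real^'s::{finite,linorder}^'m \<Rightarrow> 'b)"
proof -
  let ?J = "hcat (mat 1 :: real^'s::{finite,linorder}^'s::{finite,linorder}) (\<lambda>_. 0) :: real^'n::{finite,linorder}^'s::{finite,linorder}"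
  have "zero_pad_restr h = (\<lambda>K :: real^'s::{finite,linorder}^'m. h (K ** ?J))"
    unfolding zero_pad_restr_def by (intro ext arg_cong[where f = h] hcat_zero_eq_mult)
  moreover have "C_k_on k UNIV (\<lambda>K :: real^'s::{finite,linorder}^'m. h (K ** ?J))" for k
  proof (rule C_k_on_compose[OF open_UNIV])
    show "C_k_on k UNIV h" using assms by (simp add: smooth_on_def)
    show "C_k_on k UNIV (\<lambda>K :: real^'s::{finite,linorder}^'m. K ** ?J)"
      by (intro C_k_on_linear linear_mult_right[unfolded linear_conv_bounded_linear] open_UNIV)
  qed simp
  ultimately show ?thesis by (simp add: smooth_on_def)
qed

theorem proposition3:
  fixes h :: "real^'n::{finite,linorder}^'m::finite \<Rightarrow> real^'q::finite"
    and X :: "real^'n::{finite,linorder}^'m::finite"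
    and H :: "real^'s::{finite,linorder}^'m::finite"
    and V :: "real^'s::{finite,linorder}^'n::{finite,linorder}"
  assumes "smooth_on UNIV h"
    and "\<And>Y Q. orthogonal_matrix Q \<Longrightarrow> h (Y ** Q) = h Y"
    and "\<And>Y. Y \<in> zero_set h \<Longrightarrow> dim (range (frechet_derivative h (at Y))) = CARD('q)"
    and "CARD('s) \<le> CARD('n)"
    and "X \<in> zero_set h"
    and "V \<in> Stiefel"
    and "X = H ** transpose V"
  shows "(\<forall>Vp \<in> col_mats (CARD('n) - CARD('s)). orthogonal_matrix (hcat V Vp) \<longrightarrow>
            tangent_space_at (zero_set h) X =
              {K ** transpose V + cols_mult_transpose (CARD('n) - CARD('s)) B Vp | K B.
                 K \<in> tangent_space_at (zero_set (zero_pad_restr h)) H \<and> B \<in> col_mats (CARD('n) - CARD('s))} \<and>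
            is_direct_sum (tangent_space_at (zero_set h) X)
              ((\<lambda>K. K ** transpose V) ` tangent_space_at (zero_set (zero_pad_restr h)) H)
              ((\<lambda>B. cols_mult_transpose (CARD('n) - CARD('s)) B Vp) ` col_mats (CARD('n) - CARD('s)))) \<and>
         normal_space_at (zero_set h) X =
           {N ** transpose V | N. N \<in> normal_space_at (zero_set (zero_pad_restr h)) H} \<and>
         normal_space_at (zero_set h) X =
           (\<lambda>N. N ** transpose V) ` normal_space_at (zero_set (zero_pad_restr h)) H"
proof -
  let ?hs = "zero_pad_restr h :: real^'s::{finite,linorder}^'m \<Rightarrow> real^'q"
  let ?D = "frechet_derivative h (at X)" and ?d = "CARD('n) - CARD('s)"
  let ?TH = "tangent_space_at (zero_set ?hs) H"
  have D: "(h has_derivative ?D) (at X)"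
    by (rule smooth_on_has_derivative[OF assms(1) UNIV_I])
  note inv = derivative_of_invariant[OF assms(2,4,6) D[unfolded assms(7)], folded assms(7)]
  have Dhs: "frechet_derivative ?hs (at H) = (\<lambda>K. ?D (K ** transpose V))"
    by (rule frechet_derivative_at[OF inv(1), symmetric])
  have linD: "linear ?D" using D by (rule has_derivative_linear)
  have "span (range ?D) = UNIV"
    using assms(3)[OF assms(5)] dim_eq_full[of "range ?D"] by simp
  then have surj: "surj ?D"
    using linear_subspace_image[OF linD subspace_UNIV] by (metis span_eq_iff)
  have surj_s: "surj (frechet_derivative ?hs (at H))"
    unfolding Dhs surj_def using surj inv(2) by (metis surjD)
  have hX: "h X = 0" using assms(5) by (simp add: zero_set_def)
  have "?hs H = 0"
    using invariant_at_Stiefel[OF assms(2,4,6), of H] hX assms(7) by simp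
  then have TH: "?TH = {K. ?D (K ** transpose V) = 0}"
    using tangent_space_zero_set[OF smooth_zero_pad_restr[OF assms(1)] _ surj_s] by (simp add: Dhs)
  have TX: "tangent_space_at (zero_set h) X = {Y. Y ** V \<in> ?TH}"
    unfolding tangent_space_zero_set[OF assms(1) hX surj] TH using inv(2) by auto
  have subTH: "subspace ?TH"
    unfolding TH by (rule linear_subspace_kernel[OF linear_compose[OF linear_mult_right linD, unfolded o_def]])
  have direct_sum: "is_direct_sum (tangent_space_at (zero_set h) X) ((\<lambda>K. K ** transpose V) ` ?TH)
      ((\<lambda>B. cols_mult_transpose ?d B Vp) ` col_mats ?d)"
    if "orthogonal_matrix (hcat V Vp)" for Vp
    unfolding orthogonal_completion_image[OF assms(4,6) that] TX
    by (rule direct_sum_of_preimage[OF assms(6) subTH])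
  have "tangent_space_at (zero_set h) X =
      {K ** transpose V + cols_mult_transpose ?d B Vp | K B. K \<in> ?TH \<and> B \<in> col_mats ?d}"
    if "orthogonal_matrix (hcat V Vp)" for Vp
    using direct_sum[OF that] unfolding is_direct_sum_def by blast
  moreover have "normal_space_at (zero_set h) X = (\<lambda>N. N ** transpose V) ` normal_space_at (zero_set ?hs) H"
    by (rule normal_space_of_preimage[OF assms(6) TX subspace_0[OF subTH]])
  ultimately show ?thesis using direct_sum by (simp add: image_def Bex_def) blast
qed

end
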